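(* Let $X$ and $Y$ be real Banach spaces, let $x_0\in S_X$, $y_0\in S_Y$, and suppose that $x_0\otimes y_0$ is a weak-norm PC in $B_{X\hat{\otimes}_\pi Y}$. Then $x_0$ is a weak-norm PC in $B_X$ and $y_0$ is a weak-norm PC in $B_Y$.
   Context: $B_Z$ and $S_Z$ denote the closed unit ball and unit sphere of a Banach space $Z$. A point $z_0\in B_Z$ is a weak-norm PC (point of continuity) in $B_Z$ if the identity map $(B_Z,\text{weak})\to(B_Z,\|\cdot\|)$ is continuous at $z_0$. $X\hat{\otimes}_\pi Y$ is the (completed) projective tensor product. *)

theory Defs
  imports "HOL-Analysis.Analysis"
begin

section \<open>Weak topology and points of continuity\<close>

definition weak_topology :: "'a::real_normed_vector topology" where
  "weak_topology =
     topology_generated_by {f -` U | (f :: 'a \<Rightarrow> real) U. bounded_linear f \<and> open U}"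

definition weak_norm_PC :: "'a::real_normed_vector set \<Rightarrow> 'a \<Rightarrow> bool" where
  "weak_norm_PC B z \<longleftrightarrow>
     topcontinuous_at (subtopology weak_topology B) (subtopology euclidean B) id z"


section \<open>Algebraic tensor product\<close>

text \<open>
  A list \<open>[(x\<^sub>1, y\<^sub>1), \<dots>, (x\<^sub>n, y\<^sub>n)]\<close> represents the tensor \<open>x\<^sub>1 \<otimes> y\<^sub>1 + \<dots> + x\<^sub>n \<otimes> y\<^sub>n\<close>,
  which is regarded as a linear functional on the space of all (not necessarily bounded)
  bilinear forms, as in Ryan's book on tensor products of Banach spaces; two lists represent
  the same tensor if and only if they induce the same functional.
\<close>

definition tensor_eval :: "('a \<Rightarrow> 'b \<Rightarrow> real) \<Rightarrow> ('a \<times> 'b) list \<Rightarrow> real" where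
  "tensor_eval A us = (\<Sum>(x, y)\<leftarrow>us. A x y)"

definition tensor_rel ::
  "('a::real_vector \<times> 'b::real_vector) list \<Rightarrow> ('a \<times> 'b) list \<Rightarrow> bool" where
  "tensor_rel us vs \<longleftrightarrow> (\<forall>A. bilinear A \<longrightarrow> tensor_eval A us = tensor_eval A vs)"

quotient_type (overloaded) ('a, 'b) tensor =
  "('a::real_vector \<times> 'b::real_vector) list" / tensor_rel
  by (auto intro!: equivpI reflpI sympI transpI simp: tensor_rel_def)

lemma tensor_eval_simps [simp]:
  "tensor_eval A [] = 0"
  "tensor_eval A ((x, y) # us) = A x y + tensor_eval A us"
  "tensor_eval A (us @ vs) = tensor_eval A us + tensor_eval A vs"
  by (simp_all add: tensor_eval_def)

lemma tensor_eval_scale: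
  assumes "bilinear A"
  shows "tensor_eval A (map (\<lambda>(x, y). (c *\<^sub>R x, y)) us) = c * tensor_eval A us"
  by (induction us) (auto simp: bilinear_lmul[OF assms] algebra_simps)

instantiation tensor :: (real_vector, real_vector) real_vector
begin

lift_definition zero_tensor :: "('a, 'b) tensor" is "[]" .

lift_definition plus_tensor :: "('a, 'b) tensor \<Rightarrow> ('a, 'b) tensor \<Rightarrow> ('a, 'b) tensor" is "(@)"
  by (simp add: tensor_rel_def)

lift_definition scaleR_tensor :: "real \<Rightarrow> ('a, 'b) tensor \<Rightarrow> ('a, 'b) tensor" is
  "\<lambda>c. map (\<lambda>(x, y). (c *\<^sub>R x, y))"
  by (simp add: tensor_rel_def tensor_eval_scale)

definition uminus_tensor :: "('a, 'b) tensor \<Rightarrow> ('a, 'b) tensor" where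
  "- u = (-1) *\<^sub>R (u :: ('a, 'b) tensor)"

definition minus_tensor :: "('a, 'b) tensor \<Rightarrow> ('a, 'b) tensor \<Rightarrow> ('a, 'b) tensor" where
  "u - v = u + (-1) *\<^sub>R (v :: ('a, 'b) tensor)"

instance
proof
  fix u v w :: "('a, 'b) tensor" and a b :: real
  show "u + v + w = u + (v + w)"
    by transfer (simp add: tensor_rel_def)
  show "u + v = v + u"
    by transfer (simp add: tensor_rel_def)
  show "0 + u = u"
    by transfer (simp add: tensor_rel_def)
  show "- u + u = 0"
    unfolding uminus_tensor_def
    by transfer (simp add: tensor_rel_def tensor_eval_scale del: scaleR_minus_left scaleR_minus1_left)
  show "u - v = u + - v"
    by (simp add: uminus_tensor_def minus_tensor_def)
  show "a *\<^sub>R (u + v) = a *\<^sub>R u + a *\<^sub>R v"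
    by transfer (simp add: tensor_rel_def)
  show "(a + b) *\<^sub>R u = a *\<^sub>R u + b *\<^sub>R u"
    by transfer (simp add: tensor_rel_def tensor_eval_scale distrib_right)
  show "a *\<^sub>R b *\<^sub>R u = (a * b) *\<^sub>R u"
    by transfer (simp add: tensor_rel_def tensor_eval_scale del: map_map)
  show "1 *\<^sub>R u = u"
    by transfer (simp add: tensor_rel_def tensor_eval_scale)
qed

end

lift_definition elem_tensor :: "'a::real_vector \<Rightarrow> 'b::real_vector \<Rightarrow> ('a, 'b) tensor"
  (infix "\<otimes>" 70) is "\<lambda>x y. [(x, y)]" .

lemma bilinear_elem_tensor: "bilinear (\<otimes>)"
  unfolding bilinear_def linear_iff
  by (intro allI conjI; transfer)
     (auto simp: tensor_rel_def bilinear_ladd bilinear_radd bilinear_lmul bilinear_rmul)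

lemma ex_tensor_list: "\<exists>us. u = (\<Sum>(x, y)\<leftarrow>us. x \<otimes> y)"
proof -
  have *: "abs_tensor us = (\<Sum>(x, y)\<leftarrow>us. x \<otimes> y)" for us :: "('a \<times> 'b) list"
  proof (induction us)
    case Nil
    show ?case by (simp add: zero_tensor_def)
  next
    case (Cons p us)
    have "abs_tensor (p # us) = abs_tensor [p] + abs_tensor us"
      by (simp add: plus_tensor.abs_eq)
    then show ?case
      by (cases p) (simp add: Cons elem_tensor.abs_eq)
  qed
  show ?thesis
    by (metis * Quotient_abs_rep[OF Quotient_tensor])
qed


lifting_forget tensor.lifting


section \<open>Projective norm\<close>

definition proj_norm_values :: "('a::real_normed_vector, 'b::real_normed_vector) tensor \<Rightarrow> real set" where
  "proj_norm_values u =
     {(\<Sum>(x, y)\<leftarrow>us. norm x * norm y) | us. u = (\<Sum>(x, y)\<leftarrow>us. x \<otimes> y)}"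

definition proj_norm :: "('a::real_normed_vector, 'b::real_normed_vector) tensor \<Rightarrow> real" where
  "proj_norm u = Inf (proj_norm_values u)"

lemma proj_norm_values_nonempty: "proj_norm_values u \<noteq> {}"
  using ex_tensor_list[of u] by (auto simp: proj_norm_values_def)

lemma proj_norm_values_nonneg: "r \<in> proj_norm_values u \<Longrightarrow> 0 \<le> r"
  by (auto simp: proj_norm_values_def intro!: sum_list_nonneg)

lemma proj_norm_le: "r \<in> proj_norm_values u \<Longrightarrow> proj_norm u \<le> r"
  unfolding proj_norm_def
  by (rule cInf_lower) (auto intro: proj_norm_values_nonneg bdd_belowI)

lemma proj_norm_nonneg [simp]: "0 \<le> proj_norm u"
  unfolding proj_norm_def
  by (rule cInf_greatest) (auto intro: proj_norm_values_nonneg simp: proj_norm_values_nonempty)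

lemma proj_norm_approx:
  assumes "e > 0"
  obtains r where "r \<in> proj_norm_values u" "r < proj_norm u + e"
  using cInf_lessD[OF proj_norm_values_nonempty, of u "proj_norm u + e"] assms that
  by (auto simp: proj_norm_def)

lemma proj_norm_zero [simp]: "proj_norm 0 = 0"
proof -
  have "0 \<in> proj_norm_values (0 :: ('a, 'b) tensor)"
    unfolding proj_norm_values_def by (rule CollectI, rule exI[of _ "[]"]) simp
  from proj_norm_le[OF this] show ?thesis
    by (simp add: antisym)
qed

lemma proj_norm_triangle: "proj_norm (u + v) \<le> proj_norm u + proj_norm v"
proof (rule field_le_epsilon)
  fix e :: real assume "e > 0"
  then have e: "e / 2 > 0" by simp
  obtain r where r: "r \<in> proj_norm_values u" "r < proj_norm u + e / 2"
    using proj_norm_approx[OF e] .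
  obtain s where s: "s \<in> proj_norm_values v" "s < proj_norm v + e / 2"
    using proj_norm_approx[OF e] .
  from r(1) obtain us where us: "r = (\<Sum>(x, y)\<leftarrow>us. norm x * norm y)" "u = (\<Sum>(x, y)\<leftarrow>us. x \<otimes> y)"
    by (auto simp: proj_norm_values_def)
  from s(1) obtain vs where vs: "s = (\<Sum>(x, y)\<leftarrow>vs. norm x * norm y)" "v = (\<Sum>(x, y)\<leftarrow>vs. x \<otimes> y)"
    by (auto simp: proj_norm_values_def)
  have "r + s \<in> proj_norm_values (u + v)"
    unfolding proj_norm_values_def by (rule CollectI, rule exI[of _ "us @ vs"]) (simp add: us vs)
  from proj_norm_le[OF this] r(2) s(2) show "proj_norm (u + v) \<le> proj_norm u + proj_norm v + e"
    by linarith
qed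

lemma proj_norm_scaleR_le: "proj_norm (c *\<^sub>R u) \<le> \<bar>c\<bar> * proj_norm u"
proof -
  have *: "proj_norm (c *\<^sub>R u) \<le> \<bar>c\<bar> * r" if "r \<in> proj_norm_values u" for r
  proof (rule proj_norm_le)
    from that obtain us where us: "r = (\<Sum>(x, y)\<leftarrow>us. norm x * norm y)" "u = (\<Sum>(x, y)\<leftarrow>us. x \<otimes> y)"
      by (auto simp: proj_norm_values_def)
    let ?vs = "map (\<lambda>(x, y). (c *\<^sub>R x, y)) us"
    have "\<bar>c\<bar> * (\<Sum>(x, y)\<leftarrow>us. norm x * norm y) = (\<Sum>(x, y)\<leftarrow>?vs. norm x * norm y)"
      by (induction us) (auto simp: algebra_simps)
    moreover have "c *\<^sub>R (\<Sum>(x, y)\<leftarrow>us. x \<otimes> y) = (\<Sum>(x, y)\<leftarrow>?vs. x \<otimes> y)"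
      by (induction us) (auto simp: scaleR_add_right bilinear_lmul[OF bilinear_elem_tensor])
    ultimately show "\<bar>c\<bar> * r \<in> proj_norm_values (c *\<^sub>R u)"
      unfolding proj_norm_values_def us by blast
  qed
  show ?thesis
  proof (rule field_le_epsilon)
    fix e :: real assume e: "e > 0"
    have "e / (\<bar>c\<bar> + 1) > 0" using e by simp
    from proj_norm_approx[OF this, of u] obtain r
      where r: "r \<in> proj_norm_values u" "r < proj_norm u + e / (\<bar>c\<bar> + 1)" .
    have "proj_norm (c *\<^sub>R u) \<le> \<bar>c\<bar> * r" using *[OF r(1)] .
    also have "\<dots> \<le> \<bar>c\<bar> * (proj_norm u + e / (\<bar>c\<bar> + 1))"
      using r(2) by (intro mult_left_mono) auto
    also have "\<dots> = \<bar>c\<bar> * proj_norm u + e * (\<bar>c\<bar> / (\<bar>c\<bar> + 1))"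
      by (simp add: algebra_simps)
    also have "\<dots> \<le> \<bar>c\<bar> * proj_norm u + e * 1"
      using e by (intro add_left_mono mult_left_mono) auto
    finally show "proj_norm (c *\<^sub>R u) \<le> \<bar>c\<bar> * proj_norm u + e" by simp
  qed
qed

lemma proj_norm_scaleR: "proj_norm (c *\<^sub>R u) = \<bar>c\<bar> * proj_norm u"
proof (cases "c = 0")
  case False
  have "proj_norm u \<le> \<bar>inverse c\<bar> * proj_norm (c *\<^sub>R u)"
    using proj_norm_scaleR_le[of "inverse c" "c *\<^sub>R u"] False by simp
  then have "\<bar>c\<bar> * proj_norm u \<le> proj_norm (c *\<^sub>R u)"
    using False by (simp add: field_simps abs_inverse)
  then show ?thesis
    using proj_norm_scaleR_le[of c u] by simp
qed simp

lemma proj_norm_minus [simp]: "proj_norm (- u) = proj_norm u"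
  using proj_norm_scaleR[of "-1" u] by simp

lemma proj_norm_commute: "proj_norm (u - v) = proj_norm (v - u)"
  using proj_norm_minus[of "u - v"] by simp

lemma proj_norm_triangle_diff: "proj_norm (u - w) \<le> proj_norm (u - v) + proj_norm (v - w)"
  using proj_norm_triangle[of "u - v" "v - w"] by simp

lemma proj_norm_diff_ineq: "\<bar>proj_norm u - proj_norm v\<bar> \<le> proj_norm (u - v)"
  using proj_norm_triangle[of "u - v" v] proj_norm_triangle[of "v - u" u] proj_norm_commute[of u v]
  by simp


lemma proj_norm_null_comparison:
  assumes "g \<longlonglongrightarrow> 0" "\<And>n. proj_norm (f n) \<le> g n"
  shows "(\<lambda>n. proj_norm (f n)) \<longlonglongrightarrow> 0"
  by (rule Lim_null_comparison[OF _ assms(1)]) (simp add: assms(2))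


section \<open>Completed projective tensor product\<close>

definition proj_Cauchy ::
  "(nat \<Rightarrow> ('a::real_normed_vector, 'b::real_normed_vector) tensor) \<Rightarrow> bool" where
  "proj_Cauchy f \<longleftrightarrow> (\<forall>e>0. \<exists>M. \<forall>m\<ge>M. \<forall>n\<ge>M. proj_norm (f m - f n) < e)"

definition proj_rel ::
  "(nat \<Rightarrow> ('a::real_normed_vector, 'b::real_normed_vector) tensor) \<Rightarrow> (nat \<Rightarrow> ('a, 'b) tensor) \<Rightarrow> bool" where
  "proj_rel f g \<longleftrightarrow>
     proj_Cauchy f \<and> proj_Cauchy g \<and> (\<lambda>n. proj_norm (f n - g n)) \<longlonglongrightarrow> 0"

lemma proj_rel_refl_iff [simp]: "proj_rel f f \<longleftrightarrow> proj_Cauchy f"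
  by (auto simp: proj_rel_def)

lemma proj_Cauchy_const [simp]: "proj_Cauchy (\<lambda>n. u)"
  by (simp add: proj_Cauchy_def)

lemma proj_Cauchy_add:
  assumes "proj_Cauchy f" "proj_Cauchy g"
  shows "proj_Cauchy (\<lambda>n. f n + g n)"
  unfolding proj_Cauchy_def
proof (intro allI impI)
  fix e :: real assume "e > 0"
  then have e: "e / 2 > 0" by simp
  obtain M where M: "\<And>m n. m \<ge> M \<Longrightarrow> n \<ge> M \<Longrightarrow> proj_norm (f m - f n) < e / 2"
    using assms(1) e unfolding proj_Cauchy_def by blast
  obtain N where N: "\<And>m n. m \<ge> N \<Longrightarrow> n \<ge> N \<Longrightarrow> proj_norm (g m - g n) < e / 2"
    using assms(2) e unfolding proj_Cauchy_def by blast
  have "proj_norm (f m + g m - (f n + g n)) < e" if "m \<ge> max M N" "n \<ge> max M N" for m n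
    using M[of m n] N[of m n] that proj_norm_triangle[of "f m - f n" "g m - g n"]
    by (simp add: algebra_simps)
  then show "\<exists>M. \<forall>m\<ge>M. \<forall>n\<ge>M. proj_norm (f m + g m - (f n + g n)) < e" by blast
qed

lemma proj_Cauchy_scaleR:
  assumes "proj_Cauchy f"
  shows "proj_Cauchy (\<lambda>n. c *\<^sub>R f n)"
  unfolding proj_Cauchy_def
proof (intro allI impI)
  fix e :: real assume e: "e > 0"
  then have "e / (\<bar>c\<bar> + 1) > 0" by simp
  then obtain M where M: "\<And>m n. m \<ge> M \<Longrightarrow> n \<ge> M \<Longrightarrow> proj_norm (f m - f n) < e / (\<bar>c\<bar> + 1)"
    using assms unfolding proj_Cauchy_def by blast
  have "proj_norm (c *\<^sub>R f m - c *\<^sub>R f n) < e" if "m \<ge> M" "n \<ge> M" for m n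
  proof -
    have "proj_norm (c *\<^sub>R f m - c *\<^sub>R f n) = \<bar>c\<bar> * proj_norm (f m - f n)"
      by (simp flip: scaleR_diff_right add: proj_norm_scaleR)
    also have "\<dots> \<le> (\<bar>c\<bar> + 1) * proj_norm (f m - f n)"
      by (intro mult_right_mono) auto
    also have "\<dots> < (\<bar>c\<bar> + 1) * (e / (\<bar>c\<bar> + 1))"
      using M[OF that] by (intro mult_strict_left_mono) auto
    also have "\<dots> = e"
      by (simp add: add_nonneg_eq_0_iff)
    finally show ?thesis .
  qed
  then show "\<exists>M. \<forall>m\<ge>M. \<forall>n\<ge>M. proj_norm (c *\<^sub>R f m - c *\<^sub>R f n) < e" by blast
qed

lemma proj_Cauchy_convergent:
  assumes "proj_Cauchy f"
  shows "convergent (\<lambda>n. proj_norm (f n))"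
proof -
  have "Cauchy (\<lambda>n. proj_norm (f n))"
    unfolding Cauchy_def dist_real_def
    using assms unfolding proj_Cauchy_def by (meson proj_norm_diff_ineq le_less_trans)
  then show ?thesis
    by (simp add: Cauchy_convergent_iff)
qed

lemma proj_rel_tendsto_cong:
  assumes "proj_rel f g" "(\<lambda>n. proj_norm (f n)) \<longlonglongrightarrow> l"
  shows "(\<lambda>n. proj_norm (g n)) \<longlonglongrightarrow> l"
proof -
  have "(\<lambda>n. proj_norm (f n) - proj_norm (g n)) \<longlonglongrightarrow> 0"
    by (rule Lim_null_comparison[where g = "\<lambda>n. proj_norm (f n - g n)"])
       (use assms(1) in \<open>simp_all add: proj_norm_diff_ineq proj_rel_def\<close>)
  from tendsto_diff[OF assms(2) this] show ?thesis by simp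
qed

text \<open>
  The completion consists of the Cauchy sequences modulo those whose difference tends to 0 in
  the projective norm. Being Hausdorff, it does not need the (true) fact that \<^const>\<open>proj_norm\<close>
  separates the points of \<open>X \<otimes> Y\<close>.
\<close>

quotient_type (overloaded) ('a, 'b) proj_tensor =
  "nat \<Rightarrow> ('a::real_normed_vector, 'b::real_normed_vector) tensor" / partial: proj_rel
proof (rule part_equivpI)
  show "\<exists>f :: nat \<Rightarrow> ('a, 'b) tensor. proj_rel f f"
    by (rule exI[of _ "\<lambda>n. 0"]) (simp add: proj_rel_def)
  show "symp (proj_rel :: (nat \<Rightarrow> ('a, 'b) tensor) \<Rightarrow> _)"
    by (rule sympI) (auto simp: proj_rel_def proj_norm_commute)
  show "transp (proj_rel :: (nat \<Rightarrow> ('a, 'b) tensor) \<Rightarrow> _)"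
  proof (rule transpI)
    fix f g h :: "nat \<Rightarrow> ('a, 'b) tensor"
    assume fg: "proj_rel f g" and gh: "proj_rel g h"
    have "(\<lambda>n. proj_norm (f n - g n) + proj_norm (g n - h n)) \<longlonglongrightarrow> 0"
      using fg gh unfolding proj_rel_def by (intro tendsto_add_zero) auto
    then have "(\<lambda>n. proj_norm (f n - h n)) \<longlonglongrightarrow> 0"
      by (rule proj_norm_null_comparison) (rule proj_norm_triangle_diff)
    then show "proj_rel f h"
      using fg gh by (simp add: proj_rel_def)
  qed
qed

instantiation proj_tensor :: (real_normed_vector, real_normed_vector) real_normed_vector
begin

lift_definition zero_proj_tensor :: "('a, 'b) proj_tensor" is "\<lambda>n. 0"
  by (simp add: proj_rel_def)

lift_definition plus_proj_tensor ::
  "('a, 'b) proj_tensor \<Rightarrow> ('a, 'b) proj_tensor \<Rightarrow> ('a, 'b) proj_tensor" is "\<lambda>f g n. f n + g n"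
proof -
  fix f f' g g' :: "nat \<Rightarrow> ('a, 'b) tensor"
  assume *: "proj_rel f f'" "proj_rel g g'"
  have "(\<lambda>n. proj_norm (f n - f' n) + proj_norm (g n - g' n)) \<longlonglongrightarrow> 0"
    using * unfolding proj_rel_def by (intro tendsto_add_zero) auto
  then have "(\<lambda>n. proj_norm ((f n - f' n) + (g n - g' n))) \<longlonglongrightarrow> 0"
    by (rule proj_norm_null_comparison) (rule proj_norm_triangle)
  then show "proj_rel (\<lambda>n. f n + g n) (\<lambda>n. f' n + g' n)"
    using * by (auto simp: proj_rel_def add_diff_add intro: proj_Cauchy_add)
qed

lift_definition scaleR_proj_tensor ::
  "real \<Rightarrow> ('a, 'b) proj_tensor \<Rightarrow> ('a, 'b) proj_tensor" is "\<lambda>c f n. c *\<^sub>R f n"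
proof -
  fix c :: real and f f' :: "nat \<Rightarrow> ('a, 'b) tensor"
  assume *: "proj_rel f f'"
  have "(\<lambda>n. \<bar>c\<bar> * proj_norm (f n - f' n)) \<longlonglongrightarrow> \<bar>c\<bar> * 0"
    using * unfolding proj_rel_def by (intro tendsto_mult_left) auto
  then show "proj_rel (\<lambda>n. c *\<^sub>R f n) (\<lambda>n. c *\<^sub>R f' n)"
    using * by (auto simp: proj_rel_def proj_norm_scaleR simp flip: scaleR_diff_right
        intro: proj_Cauchy_scaleR)
qed

lift_definition norm_proj_tensor :: "('a, 'b) proj_tensor \<Rightarrow> real" is
  "\<lambda>f. lim (\<lambda>n. proj_norm (f n))"
proof -
  fix f g :: "nat \<Rightarrow> ('a, 'b) tensor"
  assume *: "proj_rel f g"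
  then have "(\<lambda>n. proj_norm (f n)) \<longlonglongrightarrow> lim (\<lambda>n. proj_norm (f n))"
    by (simp add: proj_rel_def proj_Cauchy_convergent flip: convergent_LIMSEQ_iff)
  from limI[OF proj_rel_tendsto_cong[OF * this]]
  show "lim (\<lambda>n. proj_norm (f n)) = lim (\<lambda>n. proj_norm (g n))" by simp
qed

definition uminus_proj_tensor :: "('a, 'b) proj_tensor \<Rightarrow> ('a, 'b) proj_tensor" where
  "- u = (-1) *\<^sub>R (u :: ('a, 'b) proj_tensor)"

definition minus_proj_tensor ::
  "('a, 'b) proj_tensor \<Rightarrow> ('a, 'b) proj_tensor \<Rightarrow> ('a, 'b) proj_tensor" where
  "u - v = u + (-1) *\<^sub>R (v :: ('a, 'b) proj_tensor)"

definition sgn_proj_tensor :: "('a, 'b) proj_tensor \<Rightarrow> ('a, 'b) proj_tensor" where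
  "sgn_proj_tensor u = inverse (norm u) *\<^sub>R u"

definition dist_proj_tensor :: "('a, 'b) proj_tensor \<Rightarrow> ('a, 'b) proj_tensor \<Rightarrow> real" where
  "dist_proj_tensor u v = norm (u - v)"

definition uniformity_proj_tensor :: "(('a, 'b) proj_tensor \<times> ('a, 'b) proj_tensor) filter" where
  "uniformity_proj_tensor = (INF e\<in>{0<..}. principal {(u, v). dist u v < e})"

definition open_proj_tensor :: "('a, 'b) proj_tensor set \<Rightarrow> bool" where
  "open_proj_tensor U \<longleftrightarrow> (\<forall>u\<in>U. \<forall>\<^sub>F (u', v) in uniformity. u' = u \<longrightarrow> v \<in> U)"

instance
proof
  fix u v w :: "('a, 'b) proj_tensor" and a b :: real
  note [simp] = proj_Cauchy_add proj_Cauchy_scaleR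
  show "u + v + w = u + (v + w)"
    by transfer (simp add: add.assoc)
  show "u + v = v + u"
    by transfer (simp add: add.commute)
  show "0 + u = u"
    by transfer simp
  show "- u + u = 0"
    unfolding uminus_proj_tensor_def by transfer simp
  show "u - v = u + - v"
    by (simp add: uminus_proj_tensor_def minus_proj_tensor_def)
  show "a *\<^sub>R (u + v) = a *\<^sub>R u + a *\<^sub>R v"
    by transfer (simp add: scaleR_add_right)
  show "(a + b) *\<^sub>R u = a *\<^sub>R u + b *\<^sub>R u"
    by transfer (simp add: scaleR_add_left)
  show "a *\<^sub>R b *\<^sub>R u = (a * b) *\<^sub>R u"
    by transfer simp
  show "1 *\<^sub>R u = u"
    by transfer simp
  have lim: "(\<lambda>n. proj_norm (f n)) \<longlonglongrightarrow> lim (\<lambda>n. proj_norm (f n))"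
    if "proj_Cauchy f" for f :: "nat \<Rightarrow> ('a, 'b) tensor"
    using that by (simp add: proj_Cauchy_convergent flip: convergent_LIMSEQ_iff)
  show "norm u = 0 \<longleftrightarrow> u = 0"
  proof (transfer, goal_cases)
    case (1 f)
    then have f: "proj_Cauchy f" by simp
    show ?case
      using lim[OF f] f by (auto simp: proj_rel_def intro: limI)
  qed
  show "norm (u + v) \<le> norm u + norm v"
  proof (transfer, goal_cases)
    case (1 f g)
    then have f: "proj_Cauchy f" and g: "proj_Cauchy g" by simp_all
    show ?case
      by (rule LIMSEQ_le[OF lim[OF proj_Cauchy_add[OF f g]] tendsto_add[OF lim[OF f] lim[OF g]]])
         (simp_all add: proj_norm_triangle)
  qed
  show "norm (a *\<^sub>R u) = \<bar>a\<bar> * norm u"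
  proof (transfer, goal_cases)
    case (1 c f)
    then have f: "proj_Cauchy f" by simp
    show ?case
      by (rule limI) (auto simp: proj_norm_scaleR intro!: tendsto_mult_left lim f)
  qed
qed (simp_all add: sgn_proj_tensor_def dist_proj_tensor_def uniformity_proj_tensor_def
      open_proj_tensor_def)

end

lift_definition of_tensor ::
  "('a::real_normed_vector, 'b::real_normed_vector) tensor \<Rightarrow> ('a, 'b) proj_tensor" is "\<lambda>u n. u"
  by (simp add: proj_rel_def)

lemma of_tensor_diff: "of_tensor (u - v) = of_tensor u - of_tensor v"
  unfolding minus_proj_tensor_def by transfer simp

lemma linear_of_tensor: "linear of_tensor"
  unfolding linear_iff by (intro conjI allI; transfer) (simp_all add: proj_rel_def)

lemma norm_of_tensor: "norm (of_tensor u) = proj_norm u"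
  by transfer simp

lemma of_tensor_dense:
  assumes "e > 0"
  shows "\<exists>u. norm (z - of_tensor u) < e"
  using assms unfolding minus_proj_tensor_def
proof (transfer, goal_cases)
  case (1 e f)
  then have f: "proj_Cauchy f" by (simp add: proj_rel_def)
  from 1 have "e / 2 > 0" by simp
  then obtain M where M: "\<And>m n. m \<ge> M \<Longrightarrow> n \<ge> M \<Longrightarrow> proj_norm (f m - f n) < e / 2"
    using f unfolding proj_Cauchy_def by blast
  have "proj_Cauchy (\<lambda>n. f n - f M)"
    using proj_Cauchy_add[OF f, of "\<lambda>n. - f M"] by simp
  from proj_Cauchy_convergent[OF this]
  have "(\<lambda>n. proj_norm (f n - f M)) \<longlonglongrightarrow> lim (\<lambda>n. proj_norm (f n - f M))"
    by (simp flip: convergent_LIMSEQ_iff)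
  then have "lim (\<lambda>n. proj_norm (f n - f M)) \<le> e / 2"
    by (rule LIMSEQ_le_const2) (use M in \<open>auto intro!: exI[of _ M] less_imp_le\<close>)
  with 1 show ?case
    by (intro exI[of _ "f M"]) simp
qed

lemma of_tensor_converges:
  assumes "proj_Cauchy f"
  shows "\<exists>z. (\<lambda>n. of_tensor (f n)) \<longlonglongrightarrow> z"
proof
  have f: "proj_rel f f" using assms by (simp add: proj_rel_def)
  define z where "z = abs_proj_tensor f"
  show "(\<lambda>n. of_tensor (f n)) \<longlonglongrightarrow> z"
    unfolding lim_sequentially
  proof (intro allI impI)
    fix e :: real assume e: "e > 0"
    then have "e / 2 > 0" by simp
    then obtain M where M: "\<And>m n. m \<ge> M \<Longrightarrow> n \<ge> M \<Longrightarrow> proj_norm (f m - f n) < e / 2"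
      using assms unfolding proj_Cauchy_def by blast
    have "dist (of_tensor (f m)) z < e" if m: "m \<ge> M" for m
    proof -
      have C: "proj_Cauchy (\<lambda>n. f m + (- 1) *\<^sub>R f n)"
        by (intro proj_Cauchy_add proj_Cauchy_scaleR assms proj_Cauchy_const)
      have *: "proj_rel (\<lambda>n. (- 1) *\<^sub>R f n) (\<lambda>n. (- 1) *\<^sub>R f n)"
        using proj_Cauchy_scaleR[OF assms, of "-1"] by (simp add: proj_rel_def)
      have **: "proj_rel (\<lambda>n. f m + (- 1) *\<^sub>R f n) (\<lambda>n. f m + (- 1) *\<^sub>R f n)"
        using C by (simp add: proj_rel_def)
      have const: "proj_rel (\<lambda>n. f m) (\<lambda>n. f m)"
        by (simp add: proj_rel_def)
      have "of_tensor (f m) - z = abs_proj_tensor (\<lambda>n. f m + (- 1) *\<^sub>R f n)"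
        unfolding z_def minus_proj_tensor_def of_tensor.abs_eq scaleR_proj_tensor.abs_eq[OF f]
          plus_proj_tensor.abs_eq[OF const *] ..
      then have "norm (of_tensor (f m) - z) = lim (\<lambda>n. proj_norm (f m - f n))"
        using norm_proj_tensor.abs_eq[OF **] by simp
      moreover have "(\<lambda>n. proj_norm (f m - f n)) \<longlonglongrightarrow> lim (\<lambda>n. proj_norm (f m - f n))"
        using proj_Cauchy_convergent[OF C] by (simp flip: convergent_LIMSEQ_iff)
      then have "lim (\<lambda>n. proj_norm (f m - f n)) \<le> e / 2"
        by (rule LIMSEQ_le_const2) (use M m in \<open>auto intro!: exI[of _ M] less_imp_le\<close>)
      ultimately show ?thesis
        using e by (simp add: dist_norm)
    qed
    then show "\<exists>M. \<forall>m\<ge>M. dist (of_tensor (f m)) z < e" by blast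
  qed
qed

instance proj_tensor :: (real_normed_vector, real_normed_vector) banach
proof
  fix F :: "nat \<Rightarrow> ('a, 'b) proj_tensor"
  assume F: "Cauchy F"
  have "\<exists>u. norm (F n - of_tensor u) < inverse (real (Suc n))" for n
    by (rule of_tensor_dense) simp
  then obtain u where u: "\<And>n. norm (F n - of_tensor (u n)) < inverse (real (Suc n))"
    by metis
  have diff: "(\<lambda>n. F n - of_tensor (u n)) \<longlonglongrightarrow> 0"
    by (rule Lim_null_comparison[OF always_eventually LIMSEQ_inverse_real_of_nat])
       (use u in \<open>auto intro: less_imp_le\<close>)
  have "Cauchy (\<lambda>n. of_tensor (u n))"
    unfolding Cauchy_def
  proof (intro allI impI)
    fix e :: real assume "e > 0"
    then have e: "e / 3 > 0" by simp
    obtain M where M: "\<And>m n. m \<ge> M \<Longrightarrow> n \<ge> M \<Longrightarrow> dist (F m) (F n) < e / 3"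
      using F e unfolding Cauchy_def by blast
    obtain N where N: "\<And>n. n \<ge> N \<Longrightarrow> dist (F n - of_tensor (u n)) 0 < e / 3"
      using diff e unfolding lim_sequentially by blast
    have "dist (of_tensor (u m)) (of_tensor (u n)) < e" if "m \<ge> max M N" "n \<ge> max M N" for m n
    proof -
      have "dist (of_tensor (u m)) (of_tensor (u n)) \<le>
          dist (of_tensor (u m)) (F m) + dist (F m) (F n) + dist (F n) (of_tensor (u n))"
        by (meson add_mono dist_triangle order_refl order_trans)
      also have "\<dots> < e"
        using M[of m n] N[of m] N[of n] that by (simp add: dist_norm norm_minus_commute)
      finally show ?thesis .
    qed
    then show "\<exists>M. \<forall>m\<ge>M. \<forall>n\<ge>M. dist (of_tensor (u m)) (of_tensor (u n)) < e" by blast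
  qed
  then have "proj_Cauchy u"
    unfolding Cauchy_def proj_Cauchy_def dist_norm
    by (simp flip: of_tensor_diff add: norm_of_tensor)
  then obtain z where "(\<lambda>n. of_tensor (u n)) \<longlonglongrightarrow> z"
    using of_tensor_converges by blast
  from tendsto_add[OF diff this] show "convergent F"
    by (auto simp: convergent_def)
qed

definition proj_elem_tensor ::
  "'a::real_normed_vector \<Rightarrow> 'b::real_normed_vector \<Rightarrow> ('a, 'b) proj_tensor"
  (infix "\<otimes>\<^sub>\<pi>" 70) where
  "x \<otimes>\<^sub>\<pi> y = of_tensor (x \<otimes> y)"

end

theory Submission
  imports Defs
begin

text \<open>
  Fix \<open>y\<close> with \<open>\<parallel>y\<parallel> = 1\<close>. The map \<open>x \<mapsto> x \<otimes>\<^sub>\<pi> y\<close> is linear, and it is isometric because the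
  projective norm is a cross norm (\<open>norm_proj_elem_tensor\<close>). A linear isometry is continuous for
  the weak topologies and sends the unit ball into the unit ball, while the norm distance of two
  points can be read off from their images; so a point of continuity in the image pulls back to
  a point of continuity in the domain (\<open>weak_norm_PC_linear_isometry\<close>). Both claims of the
  proposition are instances of this, one for each factor.

  The only analytic input is the cross norm identity, more precisely
  \<open>\<parallel>x\<parallel> \<parallel>y\<parallel> \<le> \<parallel>x \<otimes> y\<parallel>\<close>. If \<open>g\<close> and \<open>f\<close> are linear functionals of norm at most 1 that attain the
  norm at \<open>x\<close> and at \<open>y\<close>, then evaluating the bilinear form \<open>g x' \<cdot> f y'\<close> on any representation
  \<open>\<Sum> x\<^sub>i \<otimes> y\<^sub>i\<close> of \<open>x \<otimes> y\<close> gives \<open>\<parallel>x\<parallel> \<parallel>y\<parallel> \<le> \<Sum> \<parallel>x\<^sub>i\<parallel> \<parallel>y\<^sub>i\<parallel>\<close>. Such norming functionals come from the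
  Hahn--Banach theorem, which is proved here by Zorn's lemma: a minimal sublinear functional is
  linear.
\<close>

section \<open>Hahn--Banach by minimal sublinear functionals\<close>

text \<open>
  Homogeneity is demanded only as an inequality; applying it to \<open>c > 0\<close> and to
  \<open>1 / c\<close> gives equality.
\<close>

definition sublinear :: "('a::real_vector \<Rightarrow> real) \<Rightarrow> bool" where
  "sublinear q \<longleftrightarrow> (\<forall>x y. q (x + y) \<le> q x + q y) \<and> (\<forall>c x. 0 \<le> c \<longrightarrow> q (c *\<^sub>R x) \<le> c * q x)"

lemma sublinearI:
  assumes "\<And>x y. q (x + y) \<le> q x + q y" and "\<And>c x. 0 \<le> c \<Longrightarrow> q (c *\<^sub>R x) \<le> c * q x"
  shows "sublinear q"
  using assms by (simp add: sublinear_def)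

lemma sublinear_add: "sublinear q \<Longrightarrow> q (x + y) \<le> q x + q y"
  by (simp add: sublinear_def)

lemma sublinear_scale_le: "sublinear q \<Longrightarrow> 0 \<le> c \<Longrightarrow> q (c *\<^sub>R x) \<le> c * q x"
  by (simp add: sublinear_def)

lemma sublinear_zero:
  assumes "sublinear q"
  shows "q 0 = 0"
  using sublinear_add[OF assms, of 0 0] sublinear_scale_le[OF assms, of 0 0] by simp

lemma sublinear_scale:
  assumes q: "sublinear q" and c: "0 \<le> c"
  shows "q (c *\<^sub>R x) = c * q x"
proof (cases "c = 0")
  case True
  then show ?thesis by (simp add: sublinear_zero[OF q])
next
  case False
  with c have c: "0 < c" by simp
  have "q x \<le> inverse c * q (c *\<^sub>R x)"
    using sublinear_scale_le[OF q, of "inverse c" "c *\<^sub>R x"] c by simp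
  then have "c * q x \<le> q (c *\<^sub>R x)"
    using c by (simp add: field_simps)
  then show ?thesis
    using sublinear_scale_le[OF q, of c x] c by simp
qed

lemma sublinear_neg:
  assumes "sublinear q"
  shows "- q (- x) \<le> q x"
  using sublinear_add[OF assms, of x "- x"] sublinear_zero[OF assms] by simp

text \<open>
  Lowers a sublinear \<open>q\<close> to a sublinear functional that takes the value \<open>- q a\<close> at \<open>- a\<close>, that is,
  one that is linear along \<open>a\<close>. Along a suitable \<open>a\<close> it would lower any nonlinear \<open>q\<close> strictly,
  and it also prescribes the value of the dominated linear functional at one point.
\<close>

definition straighten :: "'a::real_vector \<Rightarrow> ('a \<Rightarrow> real) \<Rightarrow> 'a \<Rightarrow> real" where
  "straighten a q x = (INF t\<in>{0..}. q (x + t *\<^sub>R a) - t * q a)"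

lemma straighten_le:
  assumes q: "sublinear q" and t: "0 \<le> t"
  shows "straighten a q x \<le> q (x + t *\<^sub>R a) - t * q a"
  unfolding straighten_def
proof (rule cINF_lower)
  have "- q (- x) \<le> q (x + s *\<^sub>R a) - s * q a" if "0 \<le> s" for s
    using sublinear_add[OF q, of "x + s *\<^sub>R a" "- x"] sublinear_scale[OF q that, of a] by simp
  then show "bdd_below ((\<lambda>t. q (x + t *\<^sub>R a) - t * q a) ` {0..})"
    by (intro bdd_belowI[of _ "- q (- x)"]) auto
qed (use t in simp)

lemma straighten_greatest:
  assumes "\<And>t. 0 \<le> t \<Longrightarrow> z \<le> q (x + t *\<^sub>R a) - t * q a"
  shows "z \<le> straighten a q x"
  unfolding straighten_def using assms by (intro cINF_greatest) auto

lemma straighten_le_self: "sublinear q \<Longrightarrow> straighten a q x \<le> q x"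
  using straighten_le[of q 0 a x] by simp

lemma sublinear_straighten:
  assumes q: "sublinear q"
  shows "sublinear (straighten a q)"
proof (rule sublinearI)
  fix x y
  have *: "straighten a q (x + y) \<le> (q (x + s *\<^sub>R a) - s * q a) + (q (y + t *\<^sub>R a) - t * q a)"
    if "0 \<le> s" "0 \<le> t" for s t
    using straighten_le[OF q, of "s + t" a "x + y"] that
      sublinear_add[OF q, of "x + s *\<^sub>R a" "y + t *\<^sub>R a"]
    by (simp add: algebra_simps)
  have "straighten a q (x + y) - (q (x + s *\<^sub>R a) - s * q a) \<le> straighten a q y" if "0 \<le> s" for s
    by (rule straighten_greatest) (use *[OF that] in \<open>simp add: algebra_simps\<close>)
  then have "straighten a q (x + y) - straighten a q y \<le> straighten a q x"
    by (intro straighten_greatest) (simp add: algebra_simps)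
  then show "straighten a q (x + y) \<le> straighten a q x + straighten a q y" by simp
next
  fix c :: real and x
  assume c: "0 \<le> c"
  show "straighten a q (c *\<^sub>R x) \<le> c * straighten a q x"
  proof (cases "c = 0")
    case True
    then show ?thesis
      using straighten_le_self[OF q, of a 0] sublinear_zero[OF q] by simp
  next
    case False
    with c have pos: "0 < c" by simp
    have "straighten a q (c *\<^sub>R x) / c \<le> straighten a q x"
    proof (rule straighten_greatest)
      fix t :: real assume t: "0 \<le> t"
      have "straighten a q (c *\<^sub>R x) \<le> q (c *\<^sub>R x + (c * t) *\<^sub>R a) - (c * t) * q a"
        using straighten_le[OF q, of "c * t"] t c by simp
      also have "\<dots> = c * (q (x + t *\<^sub>R a) - t * q a)"
        using sublinear_scale[OF q c, of "x + t *\<^sub>R a"] by (simp add: algebra_simps)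
      finally show "straighten a q (c *\<^sub>R x) / c \<le> q (x + t *\<^sub>R a) - t * q a"
        using pos by (simp add: field_simps)
    qed
    then show ?thesis using pos by (simp add: field_simps)
  qed
qed

text \<open>
  Along a chain the values stay above \<open>- p (- x)\<close>, so the pointwise infimum is finite; it is
  subadditive because two members of a chain can be replaced by the smaller one.
\<close>

lemma chain_lower_bound_sublinear:
  assumes p: "sublinear p" and "C \<noteq> {}"
    and C: "\<And>q. q \<in> C \<Longrightarrow> sublinear q \<and> q \<le> p"
    and chain: "\<And>q r. q \<in> C \<Longrightarrow> r \<in> C \<Longrightarrow> q \<le> r \<or> r \<le> q"
  shows "\<exists>u. sublinear u \<and> u \<le> p \<and> (\<forall>q\<in>C. u \<le> q)"
proof -
  define u where "u x = (INF q\<in>C. q x)" for x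
  have low: "u x \<le> q x" if "q \<in> C" for q x
    unfolding u_def
  proof (rule cINF_lower[OF _ that])
    have "- p (- x) \<le> r x" if "r \<in> C" for r
      using sublinear_neg[of r x] C[OF that] le_funD[of r p "- x"] by force
    then show "bdd_below ((\<lambda>q. q x) ` C)"
      by (intro bdd_belowI[of _ "- p (- x)"]) auto
  qed
  have great: "z \<le> u x" if "\<And>q. q \<in> C \<Longrightarrow> z \<le> q x" for z x
    unfolding u_def using \<open>C \<noteq> {}\<close> that by (intro cINF_greatest) auto
  have "sublinear u"
  proof (rule sublinearI)
    fix x y
    have *: "u (x + y) \<le> q x + r y" if q: "q \<in> C" and r: "r \<in> C" for q r
    proof -
      obtain s where "s \<in> C" "s \<le> q" "s \<le> r"
        using chain[OF q r] q r by auto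
      then show ?thesis
        using low[of s "x + y"] sublinear_add[of s x y] C[of s] le_funD[of s q x] le_funD[of s r y]
        by force
    qed
    have "u (x + y) - q x \<le> u y" if "q \<in> C" for q
      by (rule great) (use *[OF that] in \<open>simp add: algebra_simps\<close>)
    then have "u (x + y) - u y \<le> u x"
      by (intro great) (simp add: algebra_simps)
    then show "u (x + y) \<le> u x + u y" by simp
  next
    fix c :: real and x
    assume c: "0 \<le> c"
    show "u (c *\<^sub>R x) \<le> c * u x"
    proof (cases "c = 0")
      case True
      obtain q where "q \<in> C" using \<open>C \<noteq> {}\<close> by blast
      then show ?thesis
        using True low[of q 0] C[of q] sublinear_zero[of q] by simp
    next
      case False
      with c have pos: "0 < c" by simp
      have "u (c *\<^sub>R x) / c \<le> u x"
      proof (rule great)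
        fix q assume q: "q \<in> C"
        then have "u (c *\<^sub>R x) \<le> c * q x"
          using low[OF q, of "c *\<^sub>R x"] C[OF q] sublinear_scale[of q c x] c by simp
        then show "u (c *\<^sub>R x) / c \<le> q x"
          using pos by (simp add: field_simps)
      qed
      then show ?thesis using pos by (simp add: field_simps)
    qed
  qed
  moreover have "u \<le> p"
  proof (rule le_funI)
    fix x
    obtain q where "q \<in> C" using \<open>C \<noteq> {}\<close> by blast
    then show "u x \<le> p x"
      using low[of q x] C[of q] le_funD[of q p x] by force
  qed
  ultimately show ?thesis
    using low by (blast intro: le_funI)
qed

lemma ex_minimal_sublinear:
  assumes p: "sublinear p"
  obtains q where "sublinear q" "q \<le> p" "\<And>r. sublinear r \<Longrightarrow> r \<le> q \<Longrightarrow> r = q"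
proof -
  define S where "S = {q. sublinear q \<and> q \<le> p}"
  have "\<exists>m\<in>S. \<forall>a\<in>S. m \<ge> a \<longrightarrow> a = m"
  proof (rule predicate_Zorn)
    show "partial_order_on S (relation_of (\<ge>) S)"
      by (rule partial_order_on_relation_ofI) auto
  next
    fix C assume C: "C \<in> Chains (relation_of (\<ge>) S)"
    then have CS: "q \<in> S" if "q \<in> C" for q
      using that by (auto simp: Chains_def relation_of_def)
    show "\<exists>u\<in>S. \<forall>a\<in>C. a \<ge> u"
    proof (cases "C = {}")
      case True
      with p show ?thesis by (auto simp: S_def)
    next
      case False
      have "\<exists>u. sublinear u \<and> u \<le> p \<and> (\<forall>q\<in>C. u \<le> q)"
      proof (rule chain_lower_bound_sublinear[OF p False])
        show "sublinear q \<and> q \<le> p" if "q \<in> C" for q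
          using CS[OF that] by (simp add: S_def)
        show "q \<le> r \<or> r \<le> q" if "q \<in> C" "r \<in> C" for q r
          using C that by (auto simp: Chains_def relation_of_def)
      qed
      then show ?thesis by (auto simp: S_def)
    qed
  qed
  then show thesis
    using that by (auto simp: S_def intro: order_trans)
qed

text \<open>
  By minimality \<open>q\<close> equals its straightening along every \<open>a\<close>. The parameter \<open>t = 1\<close> then gives
  \<open>q x \<le> q (x + a) - q a\<close>, the reverse of subadditivity.
\<close>

lemma minimal_sublinear_imp_linear:
  assumes q: "sublinear q" and min: "\<And>r. sublinear r \<Longrightarrow> r \<le> q \<Longrightarrow> r = q"
  shows "linear q"
proof -
  have add: "q (x + a) = q x + q a" for x a
  proof (rule antisym[OF sublinear_add[OF q]])
    have "straighten a q = q"
      by (rule min) (auto intro: sublinear_straighten straighten_le_self q le_funI)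
    then show "q x + q a \<le> q (x + a)"
      using straighten_le[OF q, of 1 a x] by simp
  qed
  have neg: "q (- x) = - q x" for x
    using add[of x "- x"] sublinear_zero[OF q] by simp
  have "q (c *\<^sub>R x) = c *\<^sub>R q x" for c x
  proof (cases "0 \<le> c")
    case True
    then show ?thesis by (simp add: sublinear_scale[OF q])
  next
    case False
    then have "q ((- c) *\<^sub>R x) = (- c) * q x"
      by (intro sublinear_scale[OF q]) simp
    then show ?thesis by (simp add: neg)
  qed
  with add show ?thesis by (simp add: linear_iff)
qed

text \<open>
  A minimal sublinear functional below the norm straightened along \<open>a\<close> is at most \<open>- \<parallel>a\<parallel>\<close> at \<open>- a\<close>,
  hence, being linear, at least \<open>\<parallel>a\<parallel>\<close> at \<open>a\<close>.
\<close>

lemma ex_norming_functional: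
  fixes a :: "'a::real_normed_vector"
  obtains f :: "'a \<Rightarrow> real" where "linear f" "\<And>x. \<bar>f x\<bar> \<le> norm x" "f a = norm a"
proof -
  have n: "sublinear (norm :: 'a \<Rightarrow> real)"
    by (rule sublinearI) (simp_all add: norm_triangle_ineq)
  obtain f where f: "sublinear f" "f \<le> straighten a norm"
    and min: "\<And>r. sublinear r \<Longrightarrow> r \<le> f \<Longrightarrow> r = f"
    using ex_minimal_sublinear[OF sublinear_straighten[OF n]] by blast
  have lin: "linear f" by (rule minimal_sublinear_imp_linear[OF f(1) min])
  have le: "f x \<le> norm x" for x
    using le_funD[OF f(2), of x] straighten_le_self[OF n, of a x] by linarith
  have abs: "\<bar>f x\<bar> \<le> norm x" for x
    using le[of x] le[of "- x"] linear_neg[OF lin, of x] by (simp add: abs_le_iff)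
  have "f (- a) \<le> - norm a"
    using le_funD[OF f(2), of "- a"] straighten_le[OF n, of 1 a "- a"] by simp
  then have "f a = norm a"
    using le[of a] linear_neg[OF lin, of a] by simp
  from that[OF lin abs this] show thesis .
qed


section \<open>The projective norm is a cross norm\<close>

lemma abs_tensor_eq_sum: "abs_tensor us = (\<Sum>(x, y)\<leftarrow>us. x \<otimes> y)"
proof (induction us)
  case Nil
  show ?case by (simp add: zero_tensor_def)
next
  case (Cons p us)
  have "abs_tensor (p # us) = abs_tensor [p] + abs_tensor us"
    by (simp add: plus_tensor.abs_eq)
  then show ?case
    by (cases p) (simp add: Cons elem_tensor.abs_eq)
qed

lemma tensor_eval_eq_if_sum_eq:
  assumes "bilinear A" and "(\<Sum>(x, y)\<leftarrow>us. x \<otimes> y) = (\<Sum>(x, y)\<leftarrow>vs. x \<otimes> y)"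
  shows "tensor_eval A us = tensor_eval A vs"
  using assms by (simp add: tensor.abs_eq_iff tensor_rel_def flip: abs_tensor_eq_sum)

lemma proj_norm_elem_tensor: "proj_norm (x \<otimes> y) = norm x * norm y"
proof (rule antisym)
  have "norm x * norm y \<in> proj_norm_values (x \<otimes> y)"
    unfolding proj_norm_values_def by (rule CollectI, rule exI[of _ "[(x, y)]"]) simp
  then show "proj_norm (x \<otimes> y) \<le> norm x * norm y"
    by (rule proj_norm_le)
next
  obtain g where g: "linear g" "\<And>z. \<bar>g z\<bar> \<le> norm z" "g x = norm x"
    by (rule ex_norming_functional[of x]) blast
  obtain f where f: "linear f" "\<And>z. \<bar>f z\<bar> \<le> norm z" "f y = norm y"
    by (rule ex_norming_functional[of y]) blast
  define A where "A = (\<lambda>x' y'. g x' * f y')"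
  have A: "bilinear A"
    unfolding bilinear_def linear_iff A_def
    by (simp add: linear_add[OF g(1)] linear_add[OF f(1)] linear_scale[OF g(1)]
        linear_scale[OF f(1)] algebra_simps)
  have eval: "tensor_eval A us \<le> (\<Sum>(x, y)\<leftarrow>us. norm x * norm y)" for us
  proof (induction us)
    case (Cons p us)
    obtain x' y' where p: "p = (x', y')" by (cases p)
    have "A x' y' \<le> \<bar>g x'\<bar> * \<bar>f y'\<bar>"
      unfolding A_def abs_mult[symmetric] by (rule abs_ge_self)
    also have "\<dots> \<le> norm x' * norm y'"
      by (intro mult_mono g f) auto
    finally show ?case
      using Cons by (simp add: p)
  qed simp
  show "norm x * norm y \<le> proj_norm (x \<otimes> y)"
    unfolding proj_norm_def
  proof (rule cInf_greatest[OF proj_norm_values_nonempty])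
    fix r assume "r \<in> proj_norm_values (x \<otimes> y)"
    then obtain us where us: "r = (\<Sum>(x, y)\<leftarrow>us. norm x * norm y)" "x \<otimes> y = (\<Sum>(x, y)\<leftarrow>us. x \<otimes> y)"
      by (auto simp: proj_norm_values_def)
    have "norm x * norm y = tensor_eval A [(x, y)]"
      by (simp add: A_def g f)
    also have "\<dots> = tensor_eval A us"
      by (rule tensor_eval_eq_if_sum_eq[OF A]) (use us(2) in simp)
    also have "\<dots> \<le> r"
      using eval[of us] us(1) by simp
    finally show "norm x * norm y \<le> r" .
  qed
qed

lemma norm_proj_elem_tensor: "norm (x \<otimes>\<^sub>\<pi> y) = norm x * norm y"
  by (simp add: proj_elem_tensor_def norm_of_tensor proj_norm_elem_tensor)

lemma bilinear_proj_elem_tensor: "bilinear (\<otimes>\<^sub>\<pi>)"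
  unfolding bilinear_def proj_elem_tensor_def
  using bilinear_elem_tensor
  by (auto simp: bilinear_def intro: linear_compose[OF _ linear_of_tensor, unfolded o_def])


section \<open>Points of continuity and linear isometries\<close>

lemma topspace_weak_topology [simp]: "topspace weak_topology = UNIV"
proof -
  have "UNIV \<in> {f -` U | (f :: 'a \<Rightarrow> real) U. bounded_linear f \<and> open U}"
    using bounded_linear_zero open_UNIV by blast
  then show ?thesis
    unfolding weak_topology_def topology_generated_by_topspace by blast
qed

lemma continuous_map_weak_topology:
  fixes T :: "'a::real_normed_vector \<Rightarrow> 'b::real_normed_vector"
  assumes T: "bounded_linear T"
  shows "continuous_map weak_topology weak_topology T"
proof -
  have "openin weak_topology (T -` W)"
    if "W \<in> {f -` U | (f :: 'b \<Rightarrow> real) U. bounded_linear f \<and> open U}" for W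
  proof -
    from that obtain f :: "'b \<Rightarrow> real" and U where W: "W = f -` U" "bounded_linear f" "open U"
      by blast
    have "T -` W = (\<lambda>x. f (T x)) -` U"
      using W(1) by auto
    moreover have "bounded_linear (\<lambda>x. f (T x))"
      by (rule bounded_linear_compose[OF W(2) T])
    ultimately show ?thesis
      unfolding weak_topology_def using W(3) by (blast intro: topology_generated_by_Basis)
  qed
  moreover have "\<Union> {f -` U | (f :: 'b \<Rightarrow> real) U. bounded_linear f \<and> open U} = UNIV"
    using topspace_weak_topology[where ?'a = 'b] by (simp add: weak_topology_def)
  ultimately show ?thesis
    by (subst (2) weak_topology_def, intro continuous_on_generated_topo) auto
qed

lemma weak_norm_PC_iff:
  "weak_norm_PC B z \<longleftrightarrow>
     z \<in> B \<and> (\<forall>e>0. \<exists>U. openin weak_topology U \<and> z \<in> U \<and> (\<forall>w\<in>U \<inter> B. dist w z < e))"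
  (is "_ \<longleftrightarrow> ?R")
proof
  assume *: "weak_norm_PC B z"
  then have z: "z \<in> B" by (simp add: weak_norm_PC_def topcontinuous_at_def)
  have "\<exists>U. openin weak_topology U \<and> z \<in> U \<and> (\<forall>w\<in>U \<inter> B. dist w z < e)" if "e > 0" for e
  proof -
    have "openin (subtopology euclidean B) (ball z e \<inter> B)" "id z \<in> ball z e \<inter> B"
      using z that by (auto simp: openin_subtopology)
    then obtain U' where "openin (subtopology weak_topology B) U'" "z \<in> U'"
        "\<forall>w\<in>U'. id w \<in> ball z e \<inter> B"
      using * unfolding weak_norm_PC_def topcontinuous_at_def by blast
    then show ?thesis
      by (auto simp: openin_subtopology dist_commute)
  qed
  with z show ?R by blast
next
  assume R: ?R
  show "weak_norm_PC B z"
    unfolding weak_norm_PC_def topcontinuous_at_def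
  proof (intro conjI allI impI)
    fix V assume "openin (subtopology euclidean B) V \<and> id z \<in> V"
    then obtain W where W: "V = W \<inter> B" "open W" "z \<in> W"
      by (auto simp: openin_subtopology)
    then obtain e where e: "e > 0" "\<And>w. dist w z < e \<Longrightarrow> w \<in> W"
      by (auto simp: open_dist)
    then obtain U where U: "openin weak_topology U" "z \<in> U" "\<And>w. w \<in> U \<inter> B \<Longrightarrow> dist w z < e"
      using R by blast
    show "\<exists>U. openin (subtopology weak_topology B) U \<and> z \<in> U \<and> (\<forall>w\<in>U. id w \<in> V)"
    proof (intro exI conjI ballI)
      show "openin (subtopology weak_topology B) (U \<inter> B)"
        using U(1) by (auto simp: openin_subtopology)
      show "z \<in> U \<inter> B" using R U(2) by simp
      show "id w \<in> V" if "w \<in> U \<inter> B" for w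
        using that W(1) e(2) U(3) by simp
    qed
  qed (use R in auto)
qed

lemma weak_norm_PC_linear_isometry:
  fixes T :: "'a::real_normed_vector \<Rightarrow> 'b::real_normed_vector"
  assumes T: "linear T" and iso: "\<And>x. norm (T x) = norm x"
    and PC: "weak_norm_PC (cball 0 r) (T z)"
  shows "weak_norm_PC (cball 0 r) z"
  unfolding weak_norm_PC_iff
proof (intro conjI allI impI)
  show "z \<in> cball 0 r"
    using PC by (simp add: weak_norm_PC_iff iso)
next
  have "bounded_linear T"
    by (rule bounded_linear_intro[of _ 1]) (simp_all add: linear_add[OF T] linear_scale[OF T] iso)
  note cont = continuous_map_weak_topology[OF this]
  have dist: "dist (T v) (T w) = dist v w" for v w
    by (simp add: dist_norm iso flip: linear_diff[OF T])
  fix e :: real assume "e > 0"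
  then obtain U where U: "openin weak_topology U" "T z \<in> U"
      "\<And>w. w \<in> U \<inter> cball 0 r \<Longrightarrow> dist w (T z) < e"
    using PC unfolding weak_norm_PC_iff by blast
  have "openin weak_topology (T -` U)"
    using openin_continuous_map_preimage[OF cont U(1)] by (simp add: vimage_def)
  moreover have "dist w z < e" if "w \<in> T -` U \<inter> cball 0 r" for w
    using that U(3)[of "T w"] by (simp add: iso dist)
  ultimately show "\<exists>U. openin weak_topology U \<and> z \<in> U \<and> (\<forall>w\<in>U \<inter> cball 0 r. dist w z < e)"
    using U(2) by blast
qed

theorem proposition4p1:
  fixes x\<^sub>0 :: "'a::banach" and y\<^sub>0 :: "'b::banach"
  assumes "x\<^sub>0 \<in> sphere 0 1" and "y\<^sub>0 \<in> sphere 0 1"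
    and "weak_norm_PC (cball 0 1) (x\<^sub>0 \<otimes>\<^sub>\<pi> y\<^sub>0)"
  shows "weak_norm_PC (cball 0 1) x\<^sub>0 \<and> weak_norm_PC (cball 0 1) y\<^sub>0"
proof
  have left: "linear (\<lambda>x::'a. x \<otimes>\<^sub>\<pi> y\<^sub>0)" and right: "linear (\<lambda>y::'b. x\<^sub>0 \<otimes>\<^sub>\<pi> y)"
    using bilinear_proj_elem_tensor unfolding bilinear_def by blast+
  show "weak_norm_PC (cball 0 1) x\<^sub>0"
    by (rule weak_norm_PC_linear_isometry[OF left _ assms(3)])
       (use assms(2) in \<open>simp add: norm_proj_elem_tensor\<close>)
  show "weak_norm_PC (cball 0 1) y\<^sub>0"
    by (rule weak_norm_PC_linear_isometry[OF right _ assms(3)])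
       (use assms(1) in \<open>simp add: norm_proj_elem_tensor\<close>)
qed

end
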